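(* Consider the plant, the steady-state optimization problem and the standing assumptions (S1)–(S3), (J1)–(J2) described in the context. Define $$C:=\frac{(1-\rho_f)L_{f,u}+G_u^fL_{f,x}}{(1-\rho_f)^2}(1+L_h),\qquad C_1:=L_hL_{J,y}+G_y^JC,\qquad C_2:=L_{J,u}+L_hL_{J,y},$$ and, for a step size $\alpha>0$, $$M:=\begin{bmatrix}\sqrt{1-2\alpha\mu_J+\alpha^2L_{J,u}^2}+\alpha C_1 & \alpha C_2\\ G_u^f & \rho_f\end{bmatrix}.$$ Let $T\ge1$ be an integer (inner loop length) and let $\alpha>0$ be such that the spectral radius of $M$ satisfies $\rho(M)<1$. Let $\hat x_0\in\mathbb{R}^n$, $\hat u_0\in\mathcal{U}$, and let $(\hat u_k)_{k\in\mathbb{N}}$ be generated by the sequential multi-timescale feedback optimization algorithm: for each outer iteration $k=0,1,2,\dots$, set $\hat x_{k,0}=\hat x_k$, $\hat u_{k,0}=\hat u_k$, and for $t=0,1,\dots,T-1$ $$\hat y_{k,t}=\hat x_{k,t}+w_2,$$ $$\hat u_{k,t+1}=\mathrm{proj}_{\mathcal{U}}\Big(\hat u_{k,t}-\alpha\big(\nabla_uJ(\hat u_{k,t},\hat y_{k,t})+\widetilde{\nabla h}(\hat x_k,\hat u_k)^{\top}\nabla_yJ(\hat u_{k,t},\hat y_{k,t})\big)\Big),$$ $$\hat x_{k,t+1}=f(\hat x_{k,t},\hat u_{k,t})+w_1,$$ and then set $\hat u_{k+1}=\hat u_{k,T}$, $\hat x_{k+1}=\hat x_{k,T}$. Let $(\bar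 u^*,\bar y^* )$ be the optimal steady state, i.e. the optimal solution of the steady-state optimization problem. Then $(\hat u_k)$ converges to a neighborhood of $\bar u^*$ in the sense that $$\limsup_{k\to\infty}\|\hat u_k-\bar u^*\|\le\frac{\alpha^2G_y^JC(G_u^J+L_hG_y^J)}{1-\rho(M)}\left[\frac{L_h}{1-\rho_f}+(T-1)\left(1+\frac{G_u^f}{1-\rho_f}\right)\right].$$
   Context: Plant: $x^+=f(x,u)+w_1$, $y=g(x,u)+w_2$ with state $x\in\mathbb{R}^n$, input $u\in\mathcal{U}\subseteq\mathbb{R}^p$, output $y\in\mathbb{R}^m$, and constant (unknown) disturbance vectors $w=(w_1,w_2)$. The output map is $g(x,u)=x$ (so $m=n$). $\mathcal{U}$ is convex and compact, $f:\mathbb{R}^n\times\mathbb{R}^p\to\mathbb{R}^n$ is continuously differentiable, and $I-\nabla_xf(x,u)$ is invertible for all $x,u$ ($\nabla_xf,\nabla_uf$ denote the partial Jacobian matrices). The steady-state map $\phi$ satisfies $\phi(u,w_1)=f(\phi(u,w_1),u)+w_1$ for all $u\in\mathcal{U}$, and the steady-state input-output map is $h(u)=h(u,w):=g(\phi(u,w_1),u)+w_2=\phi(u,w_1)+w_2$. All norms are Euclidean norms and induced matrix norms; $\mathrm{proj}_{\mathcal{U}}$ is Euclidean projection onto $\mathcal{U}$; $\rho(\cdot)$ of a matrix is its spectral radius. Assumptions on the system: (S1) $\sup_{(x,u)\in\mathbb{R}^n\times\mathcal{U}}\|\nabla_xf(x,u)\|\le\rho_f$ for some $\rho_f\in(0,1)$.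 (S2) $\|\nabla_uf(x,u)\|\le G_u^f$, and for all $x_1,x_2\in\mathbb{R}^n$, $u_1,u_2\in\mathcal{U}$: $\|\nabla_xf(x_1,u_1)-\nabla_xf(x_2,u_2)\|\le L_{f,x}(\|x_1-x_2\|+\|u_1-u_2\|)$ and $\|\nabla_uf(x_1,u_1)-\nabla_uf(x_2,u_2)\|\le L_{f,u}(\|x_1-x_2\|+\|u_1-u_2\|)$. (S3) $\|h(u_1)-h(u_2)\|\le L_h\|u_1-u_2\|$ for all $u_1,u_2\in\mathcal{U}$. Assumptions on the cost $J:\mathcal{U}\times\mathbb{R}^m\to\mathbb{R}$ (with partial gradients $\nabla_uJ,\nabla_yJ$): (J1) There are constants $G_u^J,G_y^J,L_{J,u},L_{J,y}>0$ such that for all $u_1,u_2\in\mathcal{U}$, $y_1,y_2\in\mathbb{R}^m$: $\|\nabla_uJ(u_1,y_1)\|\le G_u^J$, $\|\nabla_yJ(u_1,y_1)\|\le G_y^J$, $\|\nabla_uJ(u_1,y_1)-\nabla_uJ(u_2,y_2)\|\le L_{J,u}(\|u_1-u_2\|+\|y_1-y_2\|)$, $\|\nabla_yJ(u_1,y_1)-\nabla_yJ(u_2,y_2)\|\le L_{J,y}(\|u_1-u_2\|+\|y_1-y_2\|)$. (J2) There is $\mu_J>0$ such that for every $y\in\mathbb{R}^m$ and all $u_1,u_2\in\mathcal{U}$: $(\nabla_uJ(u_1,y)-\nabla_uJ(u_2,y))^{\top}(u_1-u_2)\ge\mu_J\|u_1-u_2\|^2$. Steady-state optimization problem: minimize $J(\bar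 u,\bar y)$ over $(\bar u,\bar y)$ subject to $\bar y=h(\bar u,w)$, $\bar u\in\mathcal{U}$. Its optimal solution $(\bar u^*,\bar y^* )$ is called the optimal steady state. Approximate sensitivity (for $g(x,u)=x$): $\widetilde{\nabla h}(x,u):=(I-\nabla_xf(x,u))^{-1}\nabla_uf(x,u)$. *)

theory Defs
  imports "Jordan_Normal_Form.Spectral_Radius" "HOL-Analysis.Analysis"
begin

definition continuously_differentiable ::
    "('a::real_normed_vector \<Rightarrow> 'b::real_normed_vector) \<Rightarrow> bool" where
  "continuously_differentiable F \<longleftrightarrow>
     (\<exists>F'. (\<forall>z. (F has_derivative blinfun_apply (F' z)) (at z)) \<and> continuous_on UNIV F')"

definition jac_x :: "(real^'n \<Rightarrow> real^'p \<Rightarrow> real^'n) \<Rightarrow> real^'n \<Rightarrow> real^'p \<Rightarrow> real^'n^'n" where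
  "jac_x f x u = jacobian (\<lambda>z. f z u) (at x)"

definition jac_u :: "(real^'n \<Rightarrow> real^'p \<Rightarrow> real^'n) \<Rightarrow> real^'n \<Rightarrow> real^'p \<Rightarrow> real^'p^'n" where
  "jac_u f x u = jacobian (\<lambda>v. f x v) (at u)"

(* The type class norm on matrices is the Frobenius norm; this is the norm induced by
   the Euclidean norms. *)
definition ind_norm :: "real^'a^'b \<Rightarrow> real" where
  "ind_norm A = onorm ((*v) A)"

(* The derivative is taken within S, because a cost on U \<times> R^m need not be defined for inputs
   outside U. If U has empty interior, the gradient in u is not unique; the statement is then
   about any choice of it. *)
definition has_gradient ::
    "('a::real_inner \<Rightarrow> real) \<Rightarrow> 'a \<Rightarrow> 'a \<Rightarrow> 'a set \<Rightarrow> bool" where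
  "has_gradient F g x S \<longleftrightarrow> (F has_derivative (\<lambda>v. g \<bullet> v)) (at x within S)"

definition ss_io_map ::
    "(real^'p \<Rightarrow> real^'n \<Rightarrow> real^'n) \<Rightarrow> real^'n \<Rightarrow> real^'n \<Rightarrow> real^'p \<Rightarrow> real^'n" where
  "ss_io_map \<phi> w1 w2 u = \<phi> u w1 + w2"

definition approx_sens ::
    "(real^'n \<Rightarrow> real^'p \<Rightarrow> real^'n) \<Rightarrow> real^'n \<Rightarrow> real^'p \<Rightarrow> real^'p^'n" where
  "approx_sens f x u =
     matrix_inv (Finite_Cartesian_Product.mat 1 - jac_x f x u) ** jac_u f x u"

definition optimal_steady_state ::
    "('u \<Rightarrow> 'y \<Rightarrow> real) \<Rightarrow> ('u \<Rightarrow> 'y) \<Rightarrow> 'u set \<Rightarrow> 'u \<Rightarrow> 'y \<Rightarrow> bool" where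
  "optimal_steady_state J h U us ys \<longleftrightarrow>
     us \<in> U \<and> ys = h us \<and> (\<forall>u\<in>U. \<forall>y. y = h u \<longrightarrow> J us ys \<le> J u y)"

(* xo k, uo k are the outer iterates; xi k t, ui k t the inner ones, constrained for t \<le> T. *)
definition multi_timescale_fo ::
    "(real^'n \<Rightarrow> real^'p \<Rightarrow> real^'n) \<Rightarrow> (real^'p \<Rightarrow> real^'n \<Rightarrow> real^'p) \<Rightarrow>
     (real^'p \<Rightarrow> real^'n \<Rightarrow> real^'n) \<Rightarrow> (real^'p) set \<Rightarrow> real^'n \<Rightarrow> real^'n \<Rightarrow> real \<Rightarrow> nat \<Rightarrow>
     (nat \<Rightarrow> real^'n) \<Rightarrow> (nat \<Rightarrow> real^'p) \<Rightarrow>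
     (nat \<Rightarrow> nat \<Rightarrow> real^'n) \<Rightarrow> (nat \<Rightarrow> nat \<Rightarrow> real^'p) \<Rightarrow> bool" where
  "multi_timescale_fo f gJu gJy U w1 w2 \<alpha> T xo uo xi ui \<longleftrightarrow>
     (\<forall>k. xi k 0 = xo k \<and> ui k 0 = uo k \<and>
        (\<forall>t<T. let y = xi k t + w2 in
           ui k (Suc t) = closest_point U (ui k t - \<alpha> *\<^sub>R
             (gJu (ui k t) y +
              Finite_Cartesian_Product.transpose (approx_sens f (xo k) (uo k)) *v gJy (ui k t) y)) \<and>
           xi k (Suc t) = f (xi k t) (ui k t) + w1) \<and>
        uo (Suc k) = ui k T \<and> xo (Suc k) = xi k T)"

end

theory Submission
  imports Defs
begin

text \<open>
  The inputs \<open>uo k\<close> converge to the optimal input \<open>us\<close> geometrically, so the upper limit on the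
  left is 0, while the right-hand side is a product of nonnegative factors. What has to be shown is
  that \<open>\<rho>(M) < 1\<close> already makes the algorithm a contraction towards the optimal steady state.

  Let \<open>xs\<close> be the optimal state, \<open>H\<close> the sensitivity at \<open>(xs, us)\<close>, and let \<open>D\<close> and \<open>X\<close> be the
  distances of the current inner iterate to \<open>us\<close> and to \<open>xs\<close>. The state recursion gives
  \<open>X' \<le> \<rho>f X + Guf D\<close>. For the input, compare the projected step with the variational inequality that
  \<open>us\<close> satisfies. This gives \<open>D' \<le> (q + \<alpha> LJy l) D + \<alpha> C2 X + \<alpha> GyJ k\<close>, where \<open>q\<close> is the
  square root in \<open>M\<close>, \<open>l\<close> bounds \<open>H\<close> on feasible directions, and \<open>k\<close> is the error of the
  sensitivity used in the outer iteration, measured against \<open>H\<close>. All products with sensitivities are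
  evaluated only on directions \<open>v - us\<close> with \<open>v \<in> U\<close>; there the Lipschitz constant of \<open>h\<close> bounds \<open>H\<close>
  even if \<open>U\<close> has empty interior.

  The crucial point is the size of \<open>k\<close>. Write \<open>A\<close> and \<open>B\<close> for the Jacobians of \<open>f\<close> in the state and in
  the input. Subtracting the equations \<open>(I - A) H = B\<close> that define the two sensitivities leaves \<open>H\<close>
  at the optimum, and not a worst-case sensitivity, as the factor of the change of \<open>A\<close>; and \<open>B\<close>
  varies with the state at most at the rate \<open>min Lfu Lfx\<close>, because mixed differences of \<open>f\<close> can be
  estimated in either order (\<open>approx_sens_deviation\<close>). With \<open>\<kappa> = Guf / (1 - \<rho>f)\<close> and
  \<open>l = min Lh \<kappa>\<close>, let \<open>bd\<close> and \<open>bx\<close> be the resulting coefficients of \<open>D\<close> and \<open>X\<close> at the start of the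
  outer iteration. They satisfy \<open>bd + \<kappa> bx \<le> \<alpha> GyJ C\<close> (\<open>sensitivity_gain_bound\<close>), so the
  contribution \<open>\<alpha> GyJ C\<close> to the term \<open>\<alpha> C1\<close> of \<open>M\<close> pays for the delayed sensitivity in full.

  Finally, \<open>\<rho>(M) < 1\<close> implies \<open>m12 m21 < (1 - m11) (1 - m22)\<close> (\<open>spectral_radius_less_1_2x2\<close>), which
  turns into the small-gain condition of \<open>two_timescale_convergence\<close>: a weighted maximum of \<open>D\<close> and
  \<open>X\<close> shrinks by a fixed factor in each outer iteration. Evaluating the sensitivity only once per
  outer iteration does no harm, since a maximum norm does not distinguish delayed from current errors.
\<close>

section \<open>Jacobians and Lipschitz bounds of the plant\<close>

lemma ind_norm_bound: "norm (A *v x) \<le> ind_norm A * norm x"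
  unfolding ind_norm_def by (rule onorm[OF matrix_vector_mul_bounded_linear])

lemma ind_norm_nonneg: "0 \<le> ind_norm A"
  unfolding ind_norm_def by (rule onorm_pos_le[OF matrix_vector_mul_bounded_linear])

text \<open>
  The total derivative splits into the two Jacobian matrices by linearity, and its two parts are
  derivatives of the sections of \<open>f\<close>, hence equal to the Jacobians by uniqueness.
\<close>

lemma has_derivative_jacobians:
  assumes "continuously_differentiable (\<lambda>(x, u). f x u)"
  shows "((\<lambda>(x, u). f x u) has_derivative (\<lambda>(dx, du). jac_x f x u *v dx + jac_u f x u *v du)) (at (x, u))"
    and "((\<lambda>z. f z u) has_derivative (\<lambda>d. jac_x f x u *v d)) (at x)"
    and "((\<lambda>v. f x v) has_derivative (\<lambda>d. jac_u f x u *v d)) (at u)"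
proof -
  obtain F where F: "\<And>z. ((\<lambda>(x, u). f x u) has_derivative blinfun_apply (F z)) (at z)"
    using assms unfolding continuously_differentiable_def by blast
  have px: "((\<lambda>z. f z u) has_derivative (\<lambda>d. blinfun_apply (F (x, u)) (d, 0))) (at x)"
  proof -
    have "((\<lambda>z. (z, u)) has_derivative (\<lambda>d. (d, 0))) (at x)"
      by (auto intro!: derivative_eq_intros)
    from has_derivative_compose[OF this F] show ?thesis by simp
  qed
  have pu: "((\<lambda>v. f x v) has_derivative (\<lambda>d. blinfun_apply (F (x, u)) (0, d))) (at u)"
  proof -
    have "((\<lambda>v. (x, v)) has_derivative (\<lambda>d. (0, d))) (at u)"
      by (auto intro!: derivative_eq_intros)
    from has_derivative_compose[OF this F] show ?thesis by simp
  qed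
  show jx: "((\<lambda>z. f z u) has_derivative (\<lambda>d. jac_x f x u *v d)) (at x)"
    unfolding jac_x_def using px by (metis differentiableI jacobian_works)
  show ju: "((\<lambda>v. f x v) has_derivative (\<lambda>d. jac_u f x u *v d)) (at u)"
    unfolding jac_u_def using pu by (metis differentiableI jacobian_works)
  have "blinfun_apply (F (x, u)) (dx, du) = jac_x f x u *v dx + jac_u f x u *v du" for dx du
  proof -
    have "blinfun_apply (F (x, u)) (dx, du)
        = blinfun_apply (F (x, u)) (dx, 0) + blinfun_apply (F (x, u)) (0, du)"
      by (metis add_0 add_Pair add_0_right blinfun.add_right)
    also have "blinfun_apply (F (x, u)) (dx, 0) = jac_x f x u *v dx"
      using has_derivative_unique[OF px jx] by metis
    also have "blinfun_apply (F (x, u)) (0, du) = jac_u f x u *v du"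
      using has_derivative_unique[OF pu ju] by metis
    finally show ?thesis .
  qed
  then have "blinfun_apply (F (x, u)) = (\<lambda>(dx, du). jac_x f x u *v dx + jac_u f x u *v du)"
    by auto
  with F[of "(x, u)"] show "((\<lambda>(x, u). f x u) has_derivative
      (\<lambda>(dx, du). jac_x f x u *v dx + jac_u f x u *v du)) (at (x, u))"
    by simp
qed

lemma lipschitz_from_jacobians:
  assumes f: "continuously_differentiable (\<lambda>(x, u). f x u)" and "convex U"
    and X: "\<And>x u. u \<in> U \<Longrightarrow> ind_norm (jac_x f x u) \<le> \<rho>"
    and G: "\<And>x u. u \<in> U \<Longrightarrow> ind_norm (jac_u f x u) \<le> G"
    and u: "u1 \<in> U" "u2 \<in> U"
  shows "norm (f x1 u1 - f x2 u2) \<le> \<rho> * norm (x1 - x2) + G * norm (u1 - u2)"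
proof -
  have "norm (f x1 u1 - f x2 u1) \<le> \<rho> * norm (x1 - x2)"
  proof (rule differentiable_bound[where S = UNIV])
    show "onorm ((*v) (jac_x f x u1)) \<le> \<rho>" for x
      using X[OF u(1)] by (simp add: ind_norm_def)
  qed (use has_derivative_jacobians(2)[OF f] in auto)
  moreover have "norm (f x2 u1 - f x2 u2) \<le> G * norm (u1 - u2)"
  proof (rule differentiable_bound[where S = U])
    show "onorm ((*v) (jac_u f x2 u)) \<le> G" if "u \<in> U" for u
      using G[OF that] by (simp add: ind_norm_def)
    show "((f x2) has_derivative (*v) (jac_u f x2 u)) (at u within U)" for u
      using has_derivative_jacobians(3)[OF f] by (rule has_derivative_at_withinI)
  qed (use assms in auto)
  moreover have "norm (f x1 u1 - f x2 u2) \<le> norm (f x1 u1 - f x2 u1) + norm (f x2 u1 - f x2 u2)"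
    by (rule norm_diff_triangle_le) auto
  ultimately show ?thesis by linarith
qed

section \<open>Derivatives along feasible directions\<close>

lemma convex_segment_mem:
  assumes "convex S" "x \<in> S" "v \<in> S" "0 \<le> t" "t \<le> 1"
  shows "x + t *\<^sub>R (v - x) \<in> S"
proof -
  have "(1 - t) *\<^sub>R x + t *\<^sub>R v \<in> S"
    using assms by (simp add: convex_alt)
  then show ?thesis by (simp add: algebra_simps)
qed

text \<open>
  A derivative within a convex set is pinned down by difference quotients only along directions that
  point into the set. Together with the two consequences below, this transfers Lipschitz bounds and
  optimality along such directions when the base point lies on the boundary.
\<close>

lemma feasible_direction_derivative:
  fixes F :: "'a::real_normed_vector \<Rightarrow> 'b::real_normed_vector"
  assumes F: "(F has_derivative F') (at x within S)" and S: "convex S" "x \<in> S" "v \<in> S"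
  shows "((\<lambda>t. (F (x + t *\<^sub>R (v - x)) - F x) /\<^sub>R t) \<longlongrightarrow> F' (v - x)) (at_right 0)"
proof -
  have sub: "(\<lambda>t. x + t *\<^sub>R (v - x)) ` {0..1} \<subseteq> S"
    using convex_segment_mem[OF S] by auto
  have "((\<lambda>t::real. x + t *\<^sub>R (v - x)) has_derivative (\<lambda>t. t *\<^sub>R (v - x))) (at 0 within {0..1})"
    by (auto intro!: derivative_eq_intros)
  moreover have "(F has_derivative F') (at (x + 0 *\<^sub>R (v - x)) within (\<lambda>t. x + t *\<^sub>R (v - x)) ` {0..1})"
    using has_derivative_subset[OF F sub] by simp
  ultimately have "((\<lambda>t. F (x + t *\<^sub>R (v - x))) has_derivative (\<lambda>t. F' (t *\<^sub>R (v - x)))) (at 0 within {0..1})"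
    by (rule has_derivative_in_compose)
  moreover have "F' (t *\<^sub>R (v - x)) = t *\<^sub>R F' (v - x)" for t
    using has_derivative_linear[OF F] by (simp add: linear_cmul)
  ultimately have "((\<lambda>t. (1 / \<bar>t\<bar>) *\<^sub>R (F (x + t *\<^sub>R (v - x)) - (F x + t *\<^sub>R F' (v - x)))) \<longlongrightarrow> 0) (at_right 0)"
    by (simp add: has_derivative_within at_within_Icc_at_right)
  then have "((\<lambda>t. (F (x + t *\<^sub>R (v - x)) - F x) /\<^sub>R t - F' (v - x)) \<longlongrightarrow> 0) (at_right 0)"
  proof (rule Lim_transform_eventually)
    show "\<forall>\<^sub>F t in at_right 0. (1 / \<bar>t\<bar>) *\<^sub>R (F (x + t *\<^sub>R (v - x)) - (F x + t *\<^sub>R F' (v - x)))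
        = (F (x + t *\<^sub>R (v - x)) - F x) /\<^sub>R t - F' (v - x)"
      using eventually_at_right_less[of "0::real"]
      by eventually_elim (simp add: algebra_simps divide_inverse)
  qed
  then show ?thesis by (simp add: LIM_zero_iff)
qed

lemma eventually_feasible:
  assumes "convex S" "x \<in> S" "v \<in> S"
  shows "\<forall>\<^sub>F t in at_right (0::real). 0 < t \<and> x + t *\<^sub>R (v - x) \<in> S"
  using convex_segment_mem[OF assms]
  unfolding eventually_at_right_field by (intro exI[of _ 1]) auto

lemma derivative_bound_feasible:
  fixes F :: "'a::real_normed_vector \<Rightarrow> 'b::real_normed_vector"
  assumes F: "(F has_derivative F') (at x within S)" and S: "convex S" "x \<in> S" "v \<in> S"
    and K: "\<And>y. y \<in> S \<Longrightarrow> norm (F y - F x) \<le> K * norm (y - x)"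
  shows "norm (F' (v - x)) \<le> K * norm (v - x)"
proof (rule tendsto_upperbound)
  show "((\<lambda>t. norm ((F (x + t *\<^sub>R (v - x)) - F x) /\<^sub>R t)) \<longlongrightarrow> norm (F' (v - x))) (at_right 0)"
    by (intro tendsto_norm feasible_direction_derivative[OF F S])
  show "\<forall>\<^sub>F t in at_right 0. norm ((F (x + t *\<^sub>R (v - x)) - F x) /\<^sub>R t) \<le> K * norm (v - x)"
    using eventually_feasible[OF S]
  proof eventually_elim
    case (elim t)
    then have "norm (F (x + t *\<^sub>R (v - x)) - F x) \<le> K * (t * norm (v - x))"
      using K[of "x + t *\<^sub>R (v - x)"] by simp
    then have "norm (F (x + t *\<^sub>R (v - x)) - F x) / t \<le> K * norm (v - x)"
      using elim by (simp add: pos_divide_le_eq mult_ac)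
    then show ?case using elim by (simp add: divide_inverse mult.commute)
  qed
qed simp

lemma derivative_nonneg_at_minimum_feasible:
  fixes F :: "'a::real_normed_vector \<Rightarrow> real"
  assumes F: "(F has_derivative F') (at x within S)" and S: "convex S" "x \<in> S" "v \<in> S"
    and min: "\<And>y. y \<in> S \<Longrightarrow> F x \<le> F y"
  shows "0 \<le> F' (v - x)"
proof (rule tendsto_lowerbound)
  show "((\<lambda>t. (F (x + t *\<^sub>R (v - x)) - F x) /\<^sub>R t) \<longlongrightarrow> F' (v - x)) (at_right 0)"
    by (rule feasible_direction_derivative[OF F S])
  show "\<forall>\<^sub>F t in at_right 0. 0 \<le> (F (x + t *\<^sub>R (v - x)) - F x) /\<^sub>R t"
    using eventually_feasible[OF S] by eventually_elim (simp add: min)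
qed simp

section \<open>Sensitivity of the steady state\<close>

text \<open>
  The Lipschitz constant of the Jacobian in the state also controls how the Jacobian in the input
  varies with the state: the difference in \<open>x\<close> of the difference of \<open>f\<close> in \<open>u\<close> can be estimated by
  the mean value inequality in \<open>x\<close>, where the derivative is a difference of state Jacobians. This
  replaces the symmetry of second derivatives, which \<open>f\<close> need not have.
\<close>

lemma jac_u_lipschitz_state:
  assumes f: "continuously_differentiable (\<lambda>(x, u). f x u)" and "convex U"
    and u: "u \<in> U" "v \<in> U"
    and L: "\<And>x1 x2 u1 u2. u1 \<in> U \<Longrightarrow> u2 \<in> U \<Longrightarrow>
         ind_norm (jac_x f x1 u1 - jac_x f x2 u2) \<le> L * (norm (x1 - x2) + norm (u1 - u2))"
  shows "norm ((jac_u f x1 u - jac_u f x2 u) *v (v - u)) \<le> L * norm (x1 - x2) * norm (v - u)"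
proof (rule derivative_bound_feasible[where F = "\<lambda>v. f x1 v - f x2 v"])
  show "((\<lambda>v. f x1 v - f x2 v) has_derivative (*v) (jac_u f x1 u - jac_u f x2 u)) (at u within U)"
    by (auto simp: matrix_vector_mult_diff_rdistrib fun_eq_iff
        intro!: derivative_eq_intros has_derivative_at_withinI[OF has_derivative_jacobians(3)[OF f]])
  fix v assume v: "v \<in> U"
  let ?g = "\<lambda>x. f x v - f x u"
  have "norm (?g x1 - ?g x2) \<le> (L * norm (v - u)) * norm (x1 - x2)"
  proof (rule differentiable_bound[where S = UNIV])
    fix x
    show "(?g has_derivative (*v) (jac_x f x v - jac_x f x u)) (at x within UNIV)"
      by (auto simp: matrix_vector_mult_diff_rdistrib fun_eq_iff
          intro!: derivative_eq_intros has_derivative_jacobians(2)[OF f])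
    show "onorm ((*v) (jac_x f x v - jac_x f x u)) \<le> L * norm (v - u)"
      using L[OF v u(1), of x x] by (simp add: ind_norm_def)
  qed auto
  then show "norm (f x1 v - f x2 v - (f x1 u - f x2 u)) \<le> L * norm (x1 - x2) * norm (v - u)"
    by (simp add: algebra_simps)
qed (use assms in auto)

lemma norm_le_of_contractive_fixed_point:
  assumes "ind_norm A \<le> \<rho>" "\<rho> < 1" and z: "z = A *v z + v"
  shows "norm z \<le> norm v / (1 - \<rho>)"
proof -
  have "norm z \<le> norm (A *v z) + norm v"
    by (metis z norm_triangle_ineq)
  also have "\<dots> \<le> \<rho> * norm z + norm v"
    using order_trans[OF ind_norm_bound mult_right_mono[OF assms(1) norm_ge_zero]] by auto
  finally show ?thesis using assms(2) by (simp add: field_simps)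
qed

text \<open>
  The fixed-point form \<open>H d = A (H d) + B d\<close> of the definition; combined with the previous lemma it
  yields norm estimates for the sensitivity without inverse matrices.
\<close>

lemma approx_sens_equation:
  assumes inv: "invertible (Finite_Cartesian_Product.mat 1 - jac_x f x u)"
  shows "approx_sens f x u *v d = jac_x f x u *v (approx_sens f x u *v d) + jac_u f x u *v d"
proof -
  let ?A = "Finite_Cartesian_Product.mat 1 - jac_x f x u"
  have "?A ** matrix_inv ?A = Finite_Cartesian_Product.mat 1"
    using someI_ex[OF inv[unfolded invertible_def]] unfolding matrix_inv_def by simp
  then have "?A *v (approx_sens f x u *v d) = jac_u f x u *v d"
    by (simp add: approx_sens_def matrix_vector_mul_assoc matrix_mul_assoc)
  then show ?thesis
    by (simp add: matrix_vector_mult_diff_rdistrib algebra_simps)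
qed

text \<open>
  A direct implicit differentiation: since \<open>g\<close> is known to be Lipschitz at \<open>us\<close>, the first-order
  remainder of \<open>f\<close> along \<open>(g u, u)\<close> is of order \<open>o(u - us)\<close>, and the error \<open>z\<close> of the linearisation
  of \<open>g\<close> solves \<open>z = A z + remainder\<close>.
\<close>

lemma steady_state_has_derivative:
  fixes f :: "real^'n \<Rightarrow> real^'p \<Rightarrow> real^'n"
  assumes f: "continuously_differentiable (\<lambda>(x, u). f x u)"
    and inv: "invertible (Finite_Cartesian_Product.mat 1 - jac_x f (g us) us)"
    and X: "ind_norm (jac_x f (g us) us) \<le> \<rho>" "\<rho> < 1"
    and g: "\<And>u. u \<in> U \<Longrightarrow> g u = f (g u) u + w" "us \<in> U"
    and L: "0 \<le> L" "\<And>u. u \<in> U \<Longrightarrow> norm (g u - g us) \<le> L * norm (u - us)"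
  shows "(g has_derivative (*v) (approx_sens f (g us) us)) (at us within U)"
  unfolding has_derivative_within_alt
proof (intro conjI allI impI)
  show "bounded_linear ((*v) (approx_sens f (g us) us))" by (rule matrix_vector_mul_bounded_linear)
  fix e :: real assume "0 < e"
  let ?A = "jac_x f (g us) us" and ?B = "jac_u f (g us) us" and ?H = "approx_sens f (g us) us"
  \<comment> \<open>undoes the factors \<open>1 + L\<close> and \<open>1 / (1 - \<rho>)\<close> that the remainder picks up below\<close>
  define e' where "e' = e * (1 - \<rho>) / (1 + L)"
  have "0 < e'" using \<open>0 < e\<close> X L by (simp add: e'_def)
  with has_derivative_jacobians(1)[OF f, of "g us" us] obtain d where "0 < d"
    and d: "\<And>x u. norm ((x, u) - (g us, us)) < d \<Longrightarrow>
      norm (f x u - f (g us) us - (?A *v (x - g us) + ?B *v (u - us))) \<le> e' * norm ((x, u) - (g us, us))"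
    unfolding has_derivative_within_alt by fastforce
  show "\<exists>d>0. \<forall>u\<in>U. norm (u - us) < d \<longrightarrow> norm (g u - g us - ?H *v (u - us)) \<le> e * norm (u - us)"
  proof (intro exI[of _ "d / (1 + L)"] conjI ballI impI)
    show "0 < d / (1 + L)" using \<open>0 < d\<close> L by simp
    fix u assume u: "u \<in> U" "norm (u - us) < d / (1 + L)"
    let ?z = "g u - g us - ?H *v (u - us)"
    let ?r = "f (g u) u - f (g us) us - (?A *v (g u - g us) + ?B *v (u - us))"
    have "norm ((g u, u) - (g us, us)) \<le> norm (g u - g us) + norm (u - us)"
      by (simp add: norm_Pair_le)
    also have "\<dots> \<le> (1 + L) * norm (u - us)"
      using L(2)[OF u(1)] by (simp add: algebra_simps)
    finally have n: "norm ((g u, u) - (g us, us)) \<le> (1 + L) * norm (u - us)" .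
    moreover have "(1 + L) * norm (u - us) < d"
      using u(2) L(1) by (simp add: field_simps)
    ultimately have "norm ?r \<le> e' * norm ((g u, u) - (g us, us))"
      by (intro d) simp
    also have "\<dots> \<le> e' * ((1 + L) * norm (u - us))"
      using n \<open>0 < e'\<close> by (intro mult_left_mono) auto
    also have "\<dots> = e * norm (u - us) * (1 - \<rho>)"
      using L(1) by (simp add: e'_def)
    finally have r: "norm ?r \<le> e * norm (u - us) * (1 - \<rho>)" .
    have "f (g u) u - f (g us) us = g u - g us"
      by (metis g u(1) add_diff_cancel_right)
    moreover have "?A *v ?z = ?A *v (g u - g us) - ?A *v (?H *v (u - us))"
      by (rule matrix_vector_mult_diff_distrib)
    ultimately have "?A *v ?z + ?r = (g u - g us) - (?A *v (?H *v (u - us)) + ?B *v (u - us))"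
      by simp
    also have "\<dots> = ?z"
      by (simp only: approx_sens_equation[OF inv, symmetric])
    finally have "?z = ?A *v ?z + ?r" ..
    then have "norm ?z \<le> norm ?r / (1 - \<rho>)"
      by (rule norm_le_of_contractive_fixed_point[OF X])
    also have "\<dots> \<le> e * norm (u - us)"
      using r X(2) by (simp add: pos_divide_le_eq)
    finally show "norm ?z \<le> e * norm (u - us)" .
  qed
qed

text \<open>
  The difference \<open>z\<close> of the two sensitivities in the direction \<open>d\<close> solves
  \<open>z = A z + (B - Bs) d + (A - As) (Hs d)\<close>. Only the fixed reference sensitivity \<open>Hs\<close> multiplies the
  change of \<open>A\<close>, and its norm enters through \<open>l\<close>. For the change of \<open>B\<close> there are two estimates: the
  Lipschitz bound on \<open>B\<close>, and moving first the input and then the state at the fixed input \<open>us\<close>,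
  where \<open>d\<close> is feasible and mixed differences apply. The stability condition requires the better of
  the two.
\<close>

lemma approx_sens_deviation:
  fixes f :: "real^'n \<Rightarrow> real^'p \<Rightarrow> real^'n"
  assumes f: "continuously_differentiable (\<lambda>(x, u). f x u)" and U: "convex U"
    and inv: "\<And>x u. invertible (Finite_Cartesian_Product.mat 1 - jac_x f x u)"
    and X: "\<And>x u. u \<in> U \<Longrightarrow> ind_norm (jac_x f x u) \<le> \<rho>" "\<rho> < 1"
    and Lfx: "\<And>x1 x2 u1 u2. u1 \<in> U \<Longrightarrow> u2 \<in> U \<Longrightarrow>
         ind_norm (jac_x f x1 u1 - jac_x f x2 u2) \<le> Lfx * (norm (x1 - x2) + norm (u1 - u2))"
    and Lfu: "\<And>x1 x2 u1 u2. u1 \<in> U \<Longrightarrow> u2 \<in> U \<Longrightarrow>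
         ind_norm (jac_u f x1 u1 - jac_u f x2 u2) \<le> Lfu * (norm (x1 - x2) + norm (u1 - u2))"
    and u: "u \<in> U" "us \<in> U" "v \<in> U"
    and l: "norm (approx_sens f xs us *v (v - us)) \<le> l * norm (v - us)"
  shows "norm ((approx_sens f x u - approx_sens f xs us) *v (v - us))
    \<le> ((Lfu + l * Lfx) * norm (u - us) + (min Lfu Lfx + l * Lfx) * norm (x - xs)) / (1 - \<rho>) * norm (v - us)"
proof -
  let ?d = "v - us" and ?D = "norm (u - us)" and ?X = "norm (x - xs)"
  let ?H = "approx_sens f x u" and ?Hs = "approx_sens f xs us"
  let ?z = "(?H - ?Hs) *v ?d"
  let ?b = "(jac_u f x u - jac_u f xs us) *v ?d"
  let ?a = "(jac_x f x u - jac_x f xs us) *v (?Hs *v ?d)"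
  have bound: "norm (N *v y) \<le> c * norm y" if "ind_norm N \<le> c" for N :: "real^'a^'b" and y c
    using order_trans[OF ind_norm_bound mult_right_mono[OF that norm_ge_zero]] .
  have b1: "norm ?b \<le> (Lfu * (?X + ?D)) * norm ?d"
    by (rule bound) (rule Lfu[OF u(1,2)])
  have "?b = (jac_u f x u - jac_u f x us) *v ?d + (jac_u f x us - jac_u f xs us) *v ?d"
    by (simp add: matrix_vector_mult_diff_rdistrib)
  then have "norm ?b \<le> norm ((jac_u f x u - jac_u f x us) *v ?d) + norm ((jac_u f x us - jac_u f xs us) *v ?d)"
    by (metis norm_triangle_ineq)
  moreover have "norm ((jac_u f x u - jac_u f x us) *v ?d) \<le> (Lfu * ?D) * norm ?d"
    using Lfu[OF u(1,2), of x x] by (intro bound) simp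
  moreover have "norm ((jac_u f x us - jac_u f xs us) *v ?d) \<le> Lfx * ?X * norm ?d"
    by (rule jac_u_lipschitz_state[OF f U u(2,3) Lfx])
  ultimately have "norm ?b \<le> (Lfu * ?D + Lfx * ?X) * norm ?d"
    by (simp add: algebra_simps)
  with b1 have b: "norm ?b \<le> (Lfu * ?D + min Lfu Lfx * ?X) * norm ?d"
    by (cases "Lfu \<le> Lfx") (simp_all add: min_def algebra_simps)
  have Lfx0: "0 \<le> Lfx * (?X + ?D)"
    using order_trans[OF ind_norm_nonneg Lfx[OF u(1,2)]] .
  have "norm ?a \<le> Lfx * (?X + ?D) * norm (?Hs *v ?d)"
    by (rule bound) (rule Lfx[OF u(1,2)])
  also have "\<dots> \<le> Lfx * (?X + ?D) * (l * norm ?d)"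
    by (rule mult_left_mono[OF l Lfx0])
  finally have a: "norm ?a \<le> Lfx * (?X + ?D) * (l * norm ?d)" .
  have "jac_x f x u *v ?z + (?b + ?a)
      = (jac_x f x u *v (?H *v ?d) + jac_u f x u *v ?d)
        - (jac_x f xs us *v (?Hs *v ?d) + jac_u f xs us *v ?d)"
    by (simp add: matrix_vector_mult_diff_rdistrib matrix_vector_mult_diff_distrib algebra_simps)
  also have "\<dots> = ?z"
    by (simp only: approx_sens_equation[OF inv, symmetric] matrix_vector_mult_diff_rdistrib)
  finally have "?z = jac_x f x u *v ?z + (?b + ?a)" ..
  then have "norm ?z \<le> norm (?b + ?a) / (1 - \<rho>)"
    by (rule norm_le_of_contractive_fixed_point[OF X(1)[OF u(1)] X(2)])
  also have "\<dots> \<le> ((Lfu * ?D + min Lfu Lfx * ?X) * norm ?d + Lfx * (?X + ?D) * (l * norm ?d)) / (1 - \<rho>)"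
    using a b X(2) norm_triangle_ineq[of ?b ?a] by (intro divide_right_mono) auto
  also have "\<dots> = ((Lfu + l * Lfx) * ?D + (min Lfu Lfx + l * Lfx) * ?X) / (1 - \<rho>) * norm ?d"
    by (simp add: algebra_simps)
  finally show ?thesis .
qed

section \<open>One projected gradient step\<close>

lemma gradient_step_contraction:
  fixes d g :: "'a::real_inner"
  assumes "\<mu> * (norm d)\<^sup>2 \<le> inner g d" "norm g \<le> L * norm d" "0 \<le> \<alpha>"
  shows "norm (d - \<alpha> *\<^sub>R g) \<le> sqrt (1 - 2 * \<alpha> * \<mu> + \<alpha>\<^sup>2 * L\<^sup>2) * norm d"
proof -
  have "(norm (d - \<alpha> *\<^sub>R g))\<^sup>2 = (norm d)\<^sup>2 - 2 * \<alpha> * inner g d + \<alpha>\<^sup>2 * (norm g)\<^sup>2"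
    unfolding power2_norm_eq_inner
    by (simp add: inner_diff inner_commute power2_eq_square algebra_simps)
  also have "\<dots> \<le> (norm d)\<^sup>2 - 2 * \<alpha> * (\<mu> * (norm d)\<^sup>2) + \<alpha>\<^sup>2 * (L * norm d)\<^sup>2"
  proof -
    have "\<alpha> * (\<mu> * (norm d)\<^sup>2) \<le> \<alpha> * inner g d"
      using assms by (intro mult_left_mono)
    moreover have "\<alpha>\<^sup>2 * (norm g)\<^sup>2 \<le> \<alpha>\<^sup>2 * (L * norm d)\<^sup>2"
      by (rule mult_left_mono[OF power_mono[OF assms(2)]]) simp_all
    ultimately show ?thesis by simp
  qed
  also have "\<dots> = (1 - 2 * \<alpha> * \<mu> + \<alpha>\<^sup>2 * L\<^sup>2) * (norm d)\<^sup>2"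
    by (simp add: power_mult_distrib algebra_simps)
  finally have "norm (d - \<alpha> *\<^sub>R g) \<le> sqrt ((1 - 2 * \<alpha> * \<mu> + \<alpha>\<^sup>2 * L\<^sup>2) * (norm d)\<^sup>2)"
    by (rule real_le_rsqrt)
  then show ?thesis by (simp only: real_sqrt_mult) simp
qed

text \<open>
  A chain rule for a cost that has only partial gradients: the Lipschitz continuity of the
  \<open>y\<close>-gradient makes the remainder \<open>R\<close> of linearising in \<open>y\<close> quadratic in \<open>u - us\<close>, which stands in
  for joint differentiability.
\<close>

lemma reduced_cost_has_derivative:
  fixes J :: "'a::euclidean_space \<Rightarrow> 'b::euclidean_space \<Rightarrow> real"
  assumes h: "(h has_derivative h') (at us within U)" "us \<in> U"
    and Lh: "0 \<le> Lh" "\<And>u. u \<in> U \<Longrightarrow> norm (h u - h us) \<le> Lh * norm (u - us)"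
    and gJu: "has_gradient (\<lambda>v. J v (h us)) gu us U"
    and gJy: "\<And>u y. u \<in> U \<Longrightarrow> has_gradient (\<lambda>z. J u z) (gJy u y) y UNIV"
    and Ly: "0 \<le> Ly" "\<And>u1 u2 y1 y2. u1 \<in> U \<Longrightarrow> u2 \<in> U \<Longrightarrow>
         norm (gJy u1 y1 - gJy u2 y2) \<le> Ly * (norm (u1 - u2) + norm (y1 - y2))"
  shows "((\<lambda>u. J u (h u)) has_derivative (\<lambda>d. inner gu d + inner (gJy us (h us)) (h' d))) (at us within U)"
proof -
  let ?gy = "gJy us (h us)"
  define R where "R = (\<lambda>u. J u (h u) - J u (h us) - inner ?gy (h u - h us))"
  have R: "norm (R u) \<le> (Ly * (1 + Lh) * Lh * norm (u - us)) * norm (u - us)" if u: "u \<in> U" for u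
  proof -
    let ?q = "\<lambda>z. J u z - inner ?gy z"
    have "norm (?q (h u) - ?q (h us)) \<le> (Ly * (1 + Lh) * norm (u - us)) * norm (h u - h us)"
    proof (rule differentiable_bound[where S = "closed_segment (h us) (h u)"])
      fix z assume z: "z \<in> closed_segment (h us) (h u)"
      show "(?q has_derivative (\<lambda>d. inner (gJy u z - ?gy) d)) (at z within closed_segment (h us) (h u))"
        unfolding inner_diff_left
      proof (rule has_derivative_diff)
        show "(J u has_derivative inner (gJy u z)) (at z within closed_segment (h us) (h u))"
          using gJy[OF u, of z] unfolding has_gradient_def by (rule has_derivative_at_withinI)
        show "(inner ?gy has_derivative inner ?gy) (at z within closed_segment (h us) (h u))"
          by (rule bounded_linear_imp_has_derivative[OF bounded_linear_inner_right])
      qed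
      have "norm (gJy u z - ?gy) \<le> Ly * (norm (u - us) + norm (z - h us))"
        by (rule Ly(2)[OF u h(2)])
      also have "\<dots> \<le> Ly * (norm (u - us) + Lh * norm (u - us))"
        using segment_bound(1)[OF z] Lh(2)[OF u] Ly(1) by (intro mult_left_mono) auto
      finally have "norm (gJy u z - ?gy) \<le> Ly * (1 + Lh) * norm (u - us)"
        by (simp add: algebra_simps)
      then have "norm (inner (gJy u z - ?gy) d) \<le> Ly * (1 + Lh) * norm (u - us) * norm d" for d
        using order_trans[OF Cauchy_Schwarz_ineq2 mult_right_mono[OF _ norm_ge_zero]] by simp
      then show "onorm (inner (gJy u z - ?gy)) \<le> Ly * (1 + Lh) * norm (u - us)"
        by (rule onorm_le)
    qed auto
    also have "\<dots> \<le> (Ly * (1 + Lh) * norm (u - us)) * (Lh * norm (u - us))"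
      using Lh Ly(1) u by (intro mult_left_mono) auto
    finally show ?thesis by (simp add: R_def inner_diff_right algebra_simps)
  qed
  have "(R has_derivative (\<lambda>_. 0)) (at us within U)"
  proof (rule has_derivativeI_sandwich[where e = 1])
    show "norm (R u - R us - 0) / norm (u - us) \<le> Ly * (1 + Lh) * Lh * norm (u - us)"
      if "u \<in> U" "u \<noteq> us" for u
      using R[OF that(1)] that(2) by (simp add: pos_divide_le_eq R_def)
    have "((\<lambda>u. Ly * (1 + Lh) * Lh * norm (u - us)) \<longlongrightarrow> Ly * (1 + Lh) * Lh * norm (us - us)) (at us within U)"
      by (intro tendsto_intros)
    then show "((\<lambda>u. Ly * (1 + Lh) * Lh * norm (u - us)) \<longlongrightarrow> 0) (at us within U)" by simp
  qed auto
  then have "((\<lambda>u. R u + J u (h us) + inner ?gy (h u - h us)) has_derivative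
      (\<lambda>d. 0 + inner gu d + inner ?gy (h' d - 0))) (at us within U)"
    using gJu unfolding has_gradient_def
    by (intro has_derivative_add bounded_linear.has_derivative[OF bounded_linear_inner_right]
        has_derivative_diff[OF h(1) has_derivative_const])
  then show ?thesis by (simp add: R_def)
qed

text \<open>
  Test the obtuse-angle characterisation of the projection \<open>p\<close> with \<open>us\<close> and the variational
  inequality at \<open>us\<close> with \<open>p\<close>, and add. Both involve the same direction \<open>p - us\<close>, so the matrices
  need to be bounded only there. The vector \<open>gu'\<close> stands for the input gradient at \<open>us\<close> with the
  current output; it separates the contractive part of the step from the output error.
\<close>

lemma projected_step_error:
  fixes K H :: "real^'p^'n"
  assumes U: "convex U" "closed U" "us \<in> U"
    and vi: "\<And>v. v \<in> U \<Longrightarrow> 0 \<le> inner gus (v - us) + inner gys (H *v (v - us))"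
    and p: "p = closest_point U (u - \<alpha> *\<^sub>R (gu + Finite_Cartesian_Product.transpose K *v gy))"
    and a: "norm (u - us - \<alpha> *\<^sub>R (gu - gu')) \<le> a"
    and b: "norm (gu' - gus) \<le> b"
    and k: "norm ((K - H) *v (p - us)) \<le> k * norm (p - us)" "norm gy \<le> G"
    and l: "norm (H *v (p - us)) \<le> l * norm (p - us)" "norm (gy - gys) \<le> c"
    and nonneg: "0 \<le> \<alpha>" "0 \<le> k" "0 \<le> l"
  shows "norm (p - us) \<le> a + \<alpha> * (b + G * k + c * l)"
proof -
  let ?d = "p - us"
  define z where "z = u - \<alpha> *\<^sub>R (gu + Finite_Cartesian_Product.transpose K *v gy)"
  have "p \<in> U" using U closest_point_in_set p by blast
  have adj: "inner (Finite_Cartesian_Product.transpose K *v gy) ?d = inner gy (K *v ?d)"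
    by (simp only: transpose_matrix_vector dot_lmul_matrix)
  have "inner (z - p) (us - p) \<le> 0"
    using closest_point_dot[OF U, of z] by (simp add: p z_def)
  then have "inner ?d ?d \<le> inner (z - us) ?d"
    by (simp add: inner_diff algebra_simps)
  also have "\<dots> = inner (u - us - \<alpha> *\<^sub>R (gu - gu')) ?d - \<alpha> * inner (gu' - gus) ?d
      - \<alpha> * inner gy ((K - H) *v ?d) - \<alpha> * inner (gy - gys) (H *v ?d)
      - \<alpha> * (inner gus ?d + inner gys (H *v ?d))"
  proof -
    have "inner (z - us) ?d = inner (u - us) ?d - \<alpha> * (inner gu ?d + inner gy (K *v ?d))"
      unfolding z_def adj[symmetric]
      by (simp only: inner_diff_left inner_add_left inner_scaleR_left)
    then show ?thesis
      by (simp only: inner_diff_left inner_scaleR_left matrix_vector_mult_diff_rdistrib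
          inner_diff_right) (simp add: algebra_simps)
  qed
  also have "\<dots> \<le> a * norm ?d + \<alpha> * (b * norm ?d) + \<alpha> * (G * (k * norm ?d)) + \<alpha> * (c * (l * norm ?d))"
  proof -
    have cs: "\<bar>inner x y\<bar> \<le> A * B" if "norm x \<le> A" "norm y \<le> B" for x y :: "real^'m" and A B
      using Cauchy_Schwarz_ineq2[of x y] mult_mono'[OF that norm_ge_zero norm_ge_zero] by linarith
    have 1: "inner (u - us - \<alpha> *\<^sub>R (gu - gu')) ?d \<le> a * norm ?d"
      using cs[OF a order_refl[of "norm ?d"]] by linarith
    have 2: "- inner (gu' - gus) ?d \<le> b * norm ?d"
      using cs[OF b order_refl[of "norm ?d"]] by linarith
    have 3: "- inner gy ((K - H) *v ?d) \<le> G * (k * norm ?d)"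
      using cs[OF k(2,1)] by linarith
    have 4: "- inner (gy - gys) (H *v ?d) \<le> c * (l * norm ?d)"
      using cs[OF l(2,1)] by linarith
    have 5: "0 \<le> \<alpha> * (inner gus ?d + inner gys (H *v ?d))"
      using vi[OF \<open>p \<in> U\<close>] nonneg(1) by simp
    show ?thesis
      using 1 mult_left_mono[OF 2 nonneg(1)] mult_left_mono[OF 3 nonneg(1)]
        mult_left_mono[OF 4 nonneg(1)] 5
      by (simp only: mult_minus_right)
  qed
  also have "\<dots> = (a + \<alpha> * (b + G * k + c * l)) * norm ?d"
    by (simp add: algebra_simps)
  finally have le: "norm ?d * norm ?d \<le> (a + \<alpha> * (b + G * k + c * l)) * norm ?d"
    by (simp add: dot_square_norm power2_eq_square)
  show ?thesis
  proof (cases "norm ?d = 0")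
    case True
    have "0 \<le> a" "0 \<le> b" "0 \<le> G" "0 \<le> c"
      using a b k(2) l(2) norm_ge_zero order_trans by blast+
    with nonneg True show ?thesis by simp
  next
    case False
    then have "0 < norm ?d" by simp
    with le show ?thesis by simp
  qed
qed

section \<open>Two coupled error sequences\<close>

lemma mat2_mult_vec_of_list:
  "map_mat complex_of_real (mat_of_rows_list 2 [[p, r], [s, t]])
      *\<^sub>v vec_of_list [complex_of_real a, complex_of_real b]
   = vec_of_list [complex_of_real (p * a + r * b), complex_of_real (s * a + t * b)]"
  (is "?L = ?R")
proof (rule eq_vecI)
  show "dim_vec ?L = dim_vec ?R" by (simp add: mat_of_rows_list_def)
  fix i assume "i < dim_vec ?R"
  then consider "i = 0" | "i = 1" by fastforce
  then show "vec_index ?L i = vec_index ?R i"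
    by cases (simp_all add: mat_of_rows_list_def scalar_prod_def numeral_2_eq_2)
qed

text \<open>
  As \<open>r * s\<close> is nonnegative, both eigenvalues \<open>l' \<le> l\<close> are real, and the characteristic
  polynomial at 1 is \<open>(1 - l) (1 - l')\<close>. The larger root \<open>l\<close> has the eigenvector \<open>(r, l - p)\<close>, which is
  nonzero because \<open>r > 0\<close>; so \<open>l < 1\<close>.
\<close>

lemma spectral_radius_less_1_2x2:
  fixes p r s t :: real
  assumes sr: "spectral_radius (map_mat complex_of_real (mat_of_rows_list 2 [[p, r], [s, t]])) < 1"
    and pos: "0 < r" "0 \<le> s"
  shows "r * s < (1 - p) * (1 - t)"
proof -
  define M where "M = map_mat complex_of_real (mat_of_rows_list 2 [[p, r], [s, t]])"
  have M: "M \<in> carrier_mat 2 2"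
    by (rule carrier_matI) (simp_all add: M_def mat_of_rows_list_def)
  define x where "x = sqrt ((p - t)\<^sup>2 + 4 * r * s)"
  have x: "0 \<le> x" "x\<^sup>2 = (p - t)\<^sup>2 + 4 * r * s"
    using pos by (simp_all add: x_def)
  define l where "l = (p + t + x) / 2"
  define l' where "l' = (p + t - x) / 2"
  have "(l - p) * (l - t) = (x\<^sup>2 - (p - t)\<^sup>2) / 4"
    unfolding l_def by (simp add: power2_eq_square field_simps)
  then have char: "(l - p) * (l - t) = r * s" using x by simp
  define v where "v = vec_of_list [complex_of_real r, complex_of_real (l - p)]"
  have "eigenvector M v (complex_of_real l)"
    unfolding eigenvector_def
  proof (intro conjI)
    show "v \<in> carrier_vec (dim_row M)" 
      using M by (auto simp: v_def intro!: carrier_vecI)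
    show "v \<noteq> 0\<^sub>v (dim_row M)"
    proof
      assume "v = 0\<^sub>v (dim_row M)"
      then have "vec_index v 0 = vec_index (0\<^sub>v (dim_row M)) 0" by simp
      then show False using M pos by (simp add: v_def)
    qed
    have e: "p * r + r * (l - p) = l * r" "s * r + t * (l - p) = l * (l - p)"
      using char by (simp_all add: algebra_simps)
    show "M *\<^sub>v v = complex_of_real l \<cdot>\<^sub>v v"
      unfolding M_def v_def mat2_mult_vec_of_list e
      by (rule eq_vecI) (auto simp: less_Suc_eq)
  qed
  then have "complex_of_real l \<in> spectrum M"
    by (auto simp: spectrum_def eigenvalue_def)
  then have "cmod (complex_of_real l) \<le> spectral_radius M"
    by (intro spectral_radius_mem_max(2)[OF M] imageI) auto
  then have "l < 1" using sr by (auto simp: M_def)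
  moreover have "l' \<le> l" using x by (simp add: l_def l'_def)
  ultimately have "0 < (1 - l) * (1 - l')" by simp
  also have "\<dots> = (1 - p) * (1 - t) - (x\<^sup>2 - (p - t)\<^sup>2) / 4"
    unfolding l_def l'_def by (simp add: power2_eq_square field_simps)
  finally show ?thesis using x by simp
qed

text \<open>
  One outer iteration in the norm \<open>max d (x / w)\<close>: the values never exceed the initial bound \<open>V\<close>, which
  keeps the delayed terms under control, and from the first step on they are below \<open>\<theta> V\<close>.
\<close>

lemma delayed_comparison:
  fixes d x :: "nat \<Rightarrow> real"
  assumes step: "\<And>t. t < T \<Longrightarrow> d (Suc t) \<le> p * d t + r * x t + bd * d 0 + bx * x 0"
    "\<And>t. t < T \<Longrightarrow> x (Suc t) \<le> s * d t + \<rho> * x t"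
    and nonneg: "0 \<le> p" "0 \<le> r" "0 \<le> bd" "0 \<le> bx" "0 \<le> s" "0 \<le> \<rho>" "0 \<le> V" "0 \<le> w"
    and \<theta>: "p + r * w + bd + bx * w \<le> \<theta>" "s + \<rho> * w \<le> \<theta> * w" "\<theta> \<le> 1"
    and start: "d 0 \<le> V" "x 0 \<le> w * V"
    and "t \<le> T"
  shows "d t \<le> V \<and> x t \<le> w * V \<and> (0 < t \<longrightarrow> d t \<le> \<theta> * V \<and> x t \<le> w * (\<theta> * V))"
  using \<open>t \<le> T\<close>
proof (induction t)
  case 0
  then show ?case using start by simp
next
  case (Suc t)
  then have IH: "d t \<le> V" "x t \<le> w * V" and t: "t < T" by auto
  have "d (Suc t) \<le> p * V + r * (w * V) + bd * V + bx * (w * V)"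
    by (rule order_trans[OF step(1)[OF t]])
      (intro add_mono mult_left_mono IH start nonneg)
  also have "\<dots> = (p + r * w + bd + bx * w) * V" by (simp add: algebra_simps)
  also have "\<dots> \<le> \<theta> * V" by (rule mult_right_mono[OF \<theta>(1) nonneg(7)])
  finally have d: "d (Suc t) \<le> \<theta> * V" .
  have "x (Suc t) \<le> s * V + \<rho> * (w * V)"
    by (rule order_trans[OF step(2)[OF t]]) (intro add_mono mult_left_mono IH nonneg)
  also have "\<dots> = (s + \<rho> * w) * V" by (simp add: algebra_simps)
  also have "\<dots> \<le> (\<theta> * w) * V" by (rule mult_right_mono[OF \<theta>(2) nonneg(7)])
  finally have x: "x (Suc t) \<le> w * (\<theta> * V)" by (simp add: mult_ac)
  have "\<theta> * V \<le> V" using mult_right_mono[OF \<theta>(3) nonneg(7)] by simp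
  moreover from this have "w * (\<theta> * V) \<le> w * V" by (rule mult_left_mono[OF _ nonneg(8)])
  ultimately show ?case using d x by linarith
qed

text \<open>
  With \<open>w = s / (1 - \<rho>)\<close> the second row of the comparison system has gain exactly 1 and the first
  gain below 1, by the small-gain condition. Enlarging \<open>w\<close> slightly makes both strict.
\<close>

lemma weighted_norm_exists:
  fixes p r bd bx s \<rho> :: real
  assumes "0 < r" "0 \<le> bx" "0 \<le> s" "0 \<le> \<rho>" "\<rho> < 1" "0 \<le> p" "0 \<le> bd"
    and gain: "s * (r + bx) < (1 - p - bd) * (1 - \<rho>)"
  obtains w \<theta> where "0 < w" "0 \<le> \<theta>" "\<theta> < 1" "p + r * w + bd + bx * w \<le> \<theta>" "s + \<rho> * w \<le> \<theta> * w"
proof -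
  define \<kappa> where "\<kappa> = s / (1 - \<rho>)"
  have \<kappa>: "0 \<le> \<kappa>" "s = \<kappa> * (1 - \<rho>)" using assms by (simp_all add: \<kappa>_def)
  have "\<kappa> * (r + bx) * (1 - \<rho>) < (1 - p - bd) * (1 - \<rho>)"
    using gain \<kappa>(2) by (simp add: mult_ac)
  then have g: "\<kappa> * (r + bx) < 1 - p - bd" using assms(5) by simp
  \<comment> \<open>uses up half of the slack in the first row\<close>
  define e where "e = (1 - p - bd - \<kappa> * (r + bx)) / (2 * (r + bx))"
  have e: "0 < e" "e * (r + bx) = (1 - p - bd - \<kappa> * (r + bx)) / 2"
    using g assms by (simp_all add: e_def field_simps)
  define w where "w = \<kappa> + e"
  have "0 < w" using \<kappa> e by (simp add: w_def)
  have 1: "p + r * w + bd + bx * w < 1"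
  proof -
    have "p + r * w + bd + bx * w = p + bd + \<kappa> * (r + bx) + e * (r + bx)"
      by (simp add: w_def algebra_simps)
    also have "\<dots> = (1 + (p + bd + \<kappa> * (r + bx))) / 2"
      unfolding e(2) by (simp add: field_simps)
    also have "\<dots> < 1" using g by simp
    finally show ?thesis .
  qed
  have "s < w * (1 - \<rho>)"
    unfolding \<kappa>(2) w_def using e(1) assms(5) by (intro mult_strict_right_mono) auto
  then have 2: "(s + \<rho> * w) / w < 1" using \<open>0 < w\<close> by (simp add: algebra_simps)
  show thesis
  proof (rule that[of w "max (p + r * w + bd + bx * w) ((s + \<rho> * w) / w)"])
    show "0 \<le> max (p + r * w + bd + bx * w) ((s + \<rho> * w) / w)"
      using assms \<open>0 < w\<close> by (simp add: le_max_iff_disj)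
    show "s + \<rho> * w \<le> max (p + r * w + bd + bx * w) ((s + \<rho> * w) / w) * w"
      using mult_right_mono[of "(s + \<rho> * w) / w" "max (p + r * w + bd + bx * w) ((s + \<rho> * w) / w)" w]
        \<open>0 < w\<close> by simp
  qed (use \<open>0 < w\<close> 1 2 in auto)
qed

lemma two_timescale_convergence:
  fixes d x :: "nat \<Rightarrow> nat \<Rightarrow> real"
  assumes step: "\<And>k t. t < T \<Longrightarrow> d k (Suc t) \<le> p * d k t + r * x k t + bd * d k 0 + bx * x k 0"
    "\<And>k t. t < T \<Longrightarrow> x k (Suc t) \<le> s * d k t + \<rho> * x k t"
    and outer: "\<And>k. d (Suc k) 0 = d k T" "\<And>k. x (Suc k) 0 = x k T" "0 < T"
    and pos: "\<And>k t. 0 \<le> d k t"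
    and nonneg: "0 < r" "0 \<le> bx" "0 \<le> s" "0 \<le> \<rho>" "\<rho> < 1" "0 \<le> p" "0 \<le> bd"
    and gain: "s * (r + bx) < (1 - p - bd) * (1 - \<rho>)"
  shows "(\<lambda>k. d k 0) \<longlonglongrightarrow> 0"
proof -
  obtain w \<theta> where w: "0 < w" "0 \<le> \<theta>" "\<theta> < 1"
    "p + r * w + bd + bx * w \<le> \<theta>" "s + \<rho> * w \<le> \<theta> * w"
    using weighted_norm_exists[OF nonneg gain] .
  define V where "V = max (d 0 0) (x 0 0 / w)"
  have "0 \<le> V" by (simp add: V_def pos le_max_iff_disj)
  have bound: "d k 0 \<le> \<theta> ^ k * V \<and> x k 0 \<le> w * (\<theta> ^ k * V)" for k
  proof (induction k)
    case 0
    have "x 0 0 / w \<le> V" "d 0 0 \<le> V" by (simp_all add: V_def)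
    then show ?case using w(1) by (simp add: pos_divide_le_eq mult.commute)
  next
    case (Suc k)
    have "d k T \<le> \<theta> * (\<theta> ^ k * V) \<and> x k T \<le> w * (\<theta> * (\<theta> ^ k * V))"
      using delayed_comparison[of T "d k" p r "x k" bd bx s \<rho> "\<theta> ^ k * V" w \<theta> T]
        step w nonneg Suc \<open>0 \<le> V\<close> \<open>0 < T\<close> by simp
    then show ?case by (simp add: outer mult.assoc)
  qed
  have lim: "(\<lambda>k. \<theta> ^ k * V) \<longlonglongrightarrow> 0"
    using tendsto_mult_right[OF LIMSEQ_realpow_zero[OF w(2,3)], of V] by simp
  show ?thesis
    by (rule tendsto_sandwich[OF _ _ tendsto_const lim])
      (simp_all add: bound pos)
qed

text \<open>
  The comparison of the delayed sensitivity error with the constant \<open>C\<close>, up to the common factor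
  \<open>1 / (1 - \<rho>f)\<close>. With \<open>l\<close> in place of \<open>Lh\<close>, the slack is \<open>(\<kappa> - l) (Lfx - Lfu)\<close> if the minimum is \<open>Lfu\<close>,
  and \<open>l (Lfu - Lfx)\<close> if it is \<open>Lfx\<close>; the minimum is what makes both nonnegative.
\<close>

lemma sensitivity_gain_bound:
  fixes Lfx Lfu l Lh \<kappa> :: real
  assumes "0 \<le> Lfx" "0 \<le> Lfu" "0 \<le> l" "l \<le> Lh" "l \<le> \<kappa>"
  shows "(Lfu + l * Lfx) + \<kappa> * (min Lfu Lfx + l * Lfx) \<le> (Lfu + \<kappa> * Lfx) * (1 + Lh)"
proof -
  have "(Lfu + l * Lfx) + \<kappa> * (min Lfu Lfx + l * Lfx) \<le> (Lfu + \<kappa> * Lfx) * (1 + l)"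
  proof (cases "Lfu \<le> Lfx")
    case True
    then have "0 \<le> (\<kappa> - l) * (Lfx - Lfu)" using assms by simp
    with True show ?thesis by (simp add: algebra_simps)
  next
    case False
    then have "0 \<le> l * (Lfu - Lfx)" using assms by simp
    with False show ?thesis by (simp add: algebra_simps)
  qed
  also have "\<dots> \<le> (Lfu + \<kappa> * Lfx) * (1 + Lh)"
    using assms by (intro mult_left_mono add_nonneg_nonneg mult_nonneg_nonneg) auto
  finally show ?thesis .
qed

section \<open>Convergence of the algorithm\<close>

theorem theorem2:
  fixes f :: "real^'n \<Rightarrow> real^'p \<Rightarrow> real^'n"
    and U :: "(real^'p) set"
    and w1 w2 :: "real^'n"
    and \<phi> :: "real^'p \<Rightarrow> real^'n \<Rightarrow> real^'n"
    and h :: "real^'p \<Rightarrow> real^'n"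
    and J :: "real^'p \<Rightarrow> real^'n \<Rightarrow> real"
    and gJu :: "real^'p \<Rightarrow> real^'n \<Rightarrow> real^'p"
    and gJy :: "real^'p \<Rightarrow> real^'n \<Rightarrow> real^'n"
    and \<rho>f Guf Lfx Lfu Lh GuJ GyJ LJu LJy \<mu>J \<alpha> C C1 C2 :: real
    and M :: "real Matrix.mat"
    and T :: nat
    and xo :: "nat \<Rightarrow> real^'n" and uo :: "nat \<Rightarrow> real^'p"
    and xi :: "nat \<Rightarrow> nat \<Rightarrow> real^'n" and ui :: "nat \<Rightarrow> nat \<Rightarrow> real^'p"
    and us :: "real^'p" and ys :: "real^'n"
  assumes U: "convex U" "compact U"
    and f_C1: "continuously_differentiable (\<lambda>(x, u). f x u)"
    and f_inv: "\<And>x u. invertible (Finite_Cartesian_Product.mat 1 - jac_x f x u)"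
    and phi: "\<And>u. u \<in> U \<Longrightarrow> \<phi> u w1 = f (\<phi> u w1) u + w1"
    and h: "h = ss_io_map \<phi> w1 w2"
    and S1: "0 < \<rho>f" "\<rho>f < 1"
      "\<And>x u. u \<in> U \<Longrightarrow> ind_norm (jac_x f x u) \<le> \<rho>f"
    and S2: "\<And>x u. u \<in> U \<Longrightarrow> ind_norm (jac_u f x u) \<le> Guf"
      "\<And>x1 x2 u1 u2. u1 \<in> U \<Longrightarrow> u2 \<in> U \<Longrightarrow>
         ind_norm (jac_x f x1 u1 - jac_x f x2 u2) \<le> Lfx * (norm (x1 - x2) + norm (u1 - u2))"
      "\<And>x1 x2 u1 u2. u1 \<in> U \<Longrightarrow> u2 \<in> U \<Longrightarrow>
         ind_norm (jac_u f x1 u1 - jac_u f x2 u2) \<le> Lfu * (norm (x1 - x2) + norm (u1 - u2))"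
    and S3: "lipschitz_on Lh U h"
    and gJu: "\<And>u y. u \<in> U \<Longrightarrow> has_gradient (\<lambda>v. J v y) (gJu u y) u U"
    and gJy: "\<And>u y. u \<in> U \<Longrightarrow> has_gradient (\<lambda>z. J u z) (gJy u y) y UNIV"
    and J1: "0 < GuJ" "0 < GyJ" "0 < LJu" "0 < LJy"
      "\<And>u y. u \<in> U \<Longrightarrow> norm (gJu u y) \<le> GuJ"
      "\<And>u y. u \<in> U \<Longrightarrow> norm (gJy u y) \<le> GyJ"
      "\<And>u1 u2 y1 y2. u1 \<in> U \<Longrightarrow> u2 \<in> U \<Longrightarrow>
         norm (gJu u1 y1 - gJu u2 y2) \<le> LJu * (norm (u1 - u2) + norm (y1 - y2))"
      "\<And>u1 u2 y1 y2. u1 \<in> U \<Longrightarrow> u2 \<in> U \<Longrightarrow>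
         norm (gJy u1 y1 - gJy u2 y2) \<le> LJy * (norm (u1 - u2) + norm (y1 - y2))"
    and J2: "0 < \<mu>J"
      "\<And>u1 u2 y. u1 \<in> U \<Longrightarrow> u2 \<in> U \<Longrightarrow>
         (gJu u1 y - gJu u2 y) \<bullet> (u1 - u2) \<ge> \<mu>J * (norm (u1 - u2))\<^sup>2"
    and C: "C = ((1 - \<rho>f) * Lfu + Guf * Lfx) / (1 - \<rho>f)\<^sup>2 * (1 + Lh)"
    and C1: "C1 = Lh * LJy + GyJ * C"
    and C2: "C2 = LJu + Lh * LJy"
    and M: "M = mat_of_rows_list 2
      [[sqrt (1 - 2 * \<alpha> * \<mu>J + \<alpha>\<^sup>2 * LJu\<^sup>2) + \<alpha> * C1, \<alpha> * C2],
       [Guf, \<rho>f]]"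
    and T: "T \<ge> 1"
    and alpha: "\<alpha> > 0"
    and rho_M: "spectral_radius (map_mat complex_of_real M) < 1"
    and u0: "uo 0 \<in> U"
    and alg: "multi_timescale_fo f gJu gJy U w1 w2 \<alpha> T xo uo xi ui"
    and opt: "optimal_steady_state J h U us ys"
  shows "limsup (\<lambda>k. ereal (norm (uo k - us))) \<le>
    ereal (\<alpha>\<^sup>2 * GyJ * C * (GuJ + Lh * GyJ) / (1 - spectral_radius (map_mat complex_of_real M)) *
      (Lh / (1 - \<rho>f) + (real T - 1) * (1 + Guf / (1 - \<rho>f))))"
proof -
  define xs where "xs = \<phi> us w1"
  have us: "us \<in> U" and ys: "ys = h us" and opt_le: "\<And>u. u \<in> U \<Longrightarrow> J us ys \<le> J u (h u)"
    using opt by (auto simp: optimal_steady_state_def)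
  have xs: "xs = f xs us + w1" unfolding xs_def by (rule phi[OF us])
  have hx: "h u = \<phi> u w1 + w2" for u by (simp add: h ss_io_map_def)
  have Lh: "0 \<le> Lh" using S3 by (rule lipschitz_on_nonneg)
  have h_lip: "norm (h u - h us) \<le> Lh * norm (u - us)" if "u \<in> U" for u
    using lipschitz_onD[OF S3 that us] by (simp add: dist_norm)
  \<comment> \<open>two distinct states show that the Lipschitz constants are nonnegative\<close>
  obtain x1 :: "real^'n" where x1: "norm x1 = 1" using vector_choose_size[of 1] by auto
  have Lfx: "0 \<le> Lfx" using order_trans[OF ind_norm_nonneg S2(2)[OF us us, of x1 0]] x1 by simp
  have Lfu: "0 \<le> Lfu" using order_trans[OF ind_norm_nonneg S2(3)[OF us us, of x1 0]] x1 by simp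
  have Guf: "0 \<le> Guf" using order_trans[OF ind_norm_nonneg S2(1)[OF us]] .
  define \<kappa> where "\<kappa> = Guf / (1 - \<rho>f)"
  have \<kappa>: "0 \<le> \<kappa>" "Guf = \<kappa> * (1 - \<rho>f)" using Guf S1 by (simp_all add: \<kappa>_def)
  \<comment> \<open>two independent bounds on the sensitivity at the optimum: from the Lipschitz constant of \<open>h\<close>,
    and from the equation it solves; \<open>sensitivity_gain_bound\<close> requires both\<close>
  define l where "l = min Lh \<kappa>"
  have l: "0 \<le> l" "l \<le> Lh" "l \<le> \<kappa>" using Lh \<kappa> by (simp_all add: l_def)
  let ?H = "approx_sens f xs us"

  have dphi: "((\<lambda>u. \<phi> u w1) has_derivative (*v) ?H) (at us within U)"
    unfolding xs_def
  proof (rule steady_state_has_derivative[OF f_C1])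
    show "invertible (Finite_Cartesian_Product.mat 1 - jac_x f (\<phi> us w1) us)" by (rule f_inv)
    show "norm (\<phi> u w1 - \<phi> us w1) \<le> Lh * norm (u - us)" if "u \<in> U" for u
      using h_lip[OF that] by (simp add: hx)
  qed (use S1 us phi Lh in auto)
  have dh: "(h has_derivative (*v) ?H) (at us within U)"
    unfolding hx[abs_def] using has_derivative_add[OF dphi has_derivative_const[of w2]] by simp
  have H_le: "norm (?H *v (v - us)) \<le> l * norm (v - us)" if v: "v \<in> U" for v
  proof -
    have "norm (?H *v (v - us)) \<le> norm (jac_u f xs us *v (v - us)) / (1 - \<rho>f)"
      by (rule norm_le_of_contractive_fixed_point[OF S1(3)[OF us] S1(2)])
        (rule approx_sens_equation[OF f_inv])
    also have "\<dots> \<le> (Guf * norm (v - us)) / (1 - \<rho>f)"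
      using S1(2) order_trans[OF ind_norm_bound mult_right_mono[OF S2(1)[OF us] norm_ge_zero]]
      by (intro divide_right_mono) auto
    finally have "norm (?H *v (v - us)) \<le> \<kappa> * norm (v - us)" by (simp add: \<kappa>_def)
    moreover have "norm (?H *v (v - us)) \<le> Lh * norm (v - us)"
      using derivative_bound_feasible[OF dh U(1) us v h_lip] by simp
    ultimately show ?thesis by (simp add: l_def min_def)
  qed

  have vi: "0 \<le> inner (gJu us ys) (v - us) + inner (gJy us ys) (?H *v (v - us))" if "v \<in> U" for v
  proof -
    have "((\<lambda>u. J u (h u)) has_derivative
        (\<lambda>d. inner (gJu us (h us)) d + inner (gJy us (h us)) (?H *v d))) (at us within U)"
      by (rule reduced_cost_has_derivative[where Lh = Lh and Ly = LJy])
        (use dh us Lh h_lip gJu gJy J1 in auto)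
    from derivative_nonneg_at_minimum_feasible[OF this U(1) us that] opt_le
    show ?thesis by (simp add: ys)
  qed

  have alg': "xi k 0 = xo k" "ui k 0 = uo k" "uo (Suc k) = ui k T" "xo (Suc k) = xi k T" for k
    using alg by (auto simp: multi_timescale_fo_def)
  have u_step: "ui k (Suc t) = closest_point U (ui k t - \<alpha> *\<^sub>R (gJu (ui k t) (xi k t + w2) +
        Finite_Cartesian_Product.transpose (approx_sens f (xo k) (uo k)) *v gJy (ui k t) (xi k t + w2)))"
    and x_step: "xi k (Suc t) = f (xi k t) (ui k t) + w1" if "t < T" for k t
    using alg that unfolding multi_timescale_fo_def Let_def by blast+
  have closed: "closed U" "U \<noteq> {}" using U us compact_imp_closed by auto
  have ui_step_U: "ui k (Suc t) \<in> U" if "t < T" for k t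
    using u_step[OF that] closest_point_in_set[OF closed] by simp
  have uo_U: "uo k \<in> U" for k
  proof (cases k)
    case (Suc k')
    with ui_step_U[of "T - 1" k'] T alg'(3)[of k'] show ?thesis by simp
  qed (simp add: u0)
  have ui_U: "ui k t \<in> U" if "t \<le> T" for k t
    using that ui_step_U[of "t - 1" k] uo_U alg'(2)[of k] by (cases t) auto

  define q where "q = sqrt (1 - 2 * \<alpha> * \<mu>J + \<alpha>\<^sup>2 * LJu\<^sup>2)"
  have q: "norm (u - us - \<alpha> *\<^sub>R (gJu u y - gJu us y)) \<le> q * norm (u - us)" if "u \<in> U" for u y
    unfolding q_def
    using J2(2)[OF that us, of y] J1(7)[OF that us, of y y] alpha
    by (intro gradient_step_contraction) simp_all

  \<comment> \<open>coefficients of the errors at the start of the outer iteration, where the sensitivity is evaluated\<close>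
  define bd where "bd = \<alpha> * GyJ * ((Lfu + l * Lfx) / (1 - \<rho>f))"
  define bx where "bx = \<alpha> * GyJ * ((min Lfu Lfx + l * Lfx) / (1 - \<rho>f))"
  have b: "0 \<le> bd" "0 \<le> bx"
    using alpha J1 Lfx Lfu l S1 by (simp_all add: bd_def bx_def)
  have C': "C = (Lfu + \<kappa> * Lfx) * (1 + Lh) / (1 - \<rho>f)"
  proof -
    have "(1 - \<rho>f) * Lfu + \<kappa> * (1 - \<rho>f) * Lfx = (1 - \<rho>f) * (Lfu + \<kappa> * Lfx)"
      by (simp add: algebra_simps)
    then show ?thesis
      using S1(2) unfolding C \<kappa>(2) by (simp add: power2_eq_square)
  qed
  have C_nonneg: "0 \<le> C" unfolding C' using Lfu Lfx \<kappa> Lh S1 by simp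
  have C2_pos: "0 < C2" using C2 J1 Lh by (simp add: add_pos_nonneg)
  have perron: "\<alpha> * C2 * Guf < (1 - (q + \<alpha> * C1)) * (1 - \<rho>f)"
    using spectral_radius_less_1_2x2[OF rho_M[unfolded M]] alpha C2_pos Guf by (simp add: q_def)
  have sens_gain: "bd + \<kappa> * bx \<le> \<alpha> * GyJ * C"
  proof -
    have "bd + \<kappa> * bx = \<alpha> * GyJ * (((Lfu + l * Lfx) + \<kappa> * (min Lfu Lfx + l * Lfx)) / (1 - \<rho>f))"
      by (simp add: bd_def bx_def add_divide_distrib algebra_simps)
    also have "\<dots> \<le> \<alpha> * GyJ * C"
      unfolding C' using sensitivity_gain_bound[OF Lfx Lfu l] S1(2) alpha J1(2)
      by (intro mult_left_mono divide_right_mono) auto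
    finally show ?thesis .
  qed
  define p where "p = q + \<alpha> * LJy * l"
  have gain: "Guf * (\<alpha> * C2 + bx) < (1 - p - bd) * (1 - \<rho>f)"
  proof -
    have "Guf * (\<alpha> * C2 + bx) = \<alpha> * C2 * Guf + (\<kappa> * bx) * (1 - \<rho>f)"
      by (simp add: \<kappa>(2) algebra_simps)
    also have "\<dots> < (1 - (q + \<alpha> * C1)) * (1 - \<rho>f) + (\<kappa> * bx) * (1 - \<rho>f)"
      using perron by simp
    also have "\<dots> = (1 - (q + \<alpha> * C1) + \<kappa> * bx) * (1 - \<rho>f)"
      by (simp add: algebra_simps)
    also have "\<dots> \<le> (1 - p - bd) * (1 - \<rho>f)"
    proof (rule mult_right_mono)
      have "\<alpha> * LJy * l \<le> \<alpha> * LJy * Lh"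
        using l alpha J1 by (intro mult_left_mono) auto
      then show "1 - (q + \<alpha> * C1) + \<kappa> * bx \<le> 1 - p - bd"
        using sens_gain by (simp add: p_def C1 algebra_simps)
    qed (use S1 in simp)
    finally show ?thesis .
  qed

  define D where "D = (\<lambda>k t. norm (ui k t - us))"
  define X where "X = (\<lambda>k t. norm (xi k t - xs))"
  have X_step: "X k (Suc t) \<le> Guf * D k t + \<rho>f * X k t" if "t < T" for k t
  proof -
    have "xi k (Suc t) - xs = f (xi k t) (ui k t) - f xs us"
      by (metis x_step[OF that] xs add_diff_cancel_right)
    moreover have "norm (f (xi k t) (ui k t) - f xs us)
        \<le> \<rho>f * norm (xi k t - xs) + Guf * norm (ui k t - us)"
      using that by (intro lipschitz_from_jacobians[OF f_C1 U(1) S1(3) S2(1)] ui_U us) auto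
    ultimately show ?thesis by (simp add: X_def D_def)
  qed
  have D_step: "D k (Suc t) \<le> p * D k t + \<alpha> * C2 * X k t + bd * D k 0 + bx * X k 0"
    if t: "t < T" for k t
  proof -
    let ?u = "ui k t" and ?y = "xi k t + w2"
    let ?K = "approx_sens f (xo k) (uo k)"
    let ?k = "((Lfu + l * Lfx) * D k 0 + (min Lfu Lfx + l * Lfx) * X k 0) / (1 - \<rho>f)"
    have u: "?u \<in> U" using ui_U t by simp
    have ydiff: "?y - ys = xi k t - xs" by (simp add: ys hx xs_def)
    have "norm (ui k (Suc t) - us) \<le> q * D k t
        + \<alpha> * (LJu * X k t + GyJ * ?k + LJy * (D k t + X k t) * l)"
    proof (rule projected_step_error[OF U(1) closed(1) us vi u_step[OF t, of k]])
      show "norm (?u - us - \<alpha> *\<^sub>R (gJu ?u ?y - gJu us ?y)) \<le> q * D k t"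
        using q[OF u] by (simp add: D_def)
      show "norm (gJu us ?y - gJu us ys) \<le> LJu * X k t"
        using J1(7)[OF us us, of ?y ys] by (simp only: ydiff X_def) simp
      show "norm ((?K - ?H) *v (ui k (Suc t) - us)) \<le> ?k * norm (ui k (Suc t) - us)"
        using approx_sens_deviation[OF f_C1 U(1) f_inv S1(3,2) S2(2,3) uo_U[of k] us
            ui_step_U[OF t, of k] H_le[OF ui_step_U[OF t, of k]], where x = "xo k"]
        by (simp add: D_def X_def alg')
      show "norm (gJy ?u ?y) \<le> GyJ" by (rule J1(6)[OF u])
      show "norm (?H *v (ui k (Suc t) - us)) \<le> l * norm (ui k (Suc t) - us)"
        by (rule H_le[OF ui_step_U[OF t]])
      show "norm (gJy ?u ?y - gJy us ys) \<le> LJy * (D k t + X k t)"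
        using J1(8)[OF u us, of ?y ys] by (simp only: ydiff X_def D_def)
      show "0 \<le> ?k" using Lfu Lfx l S1 by (simp add: D_def X_def)
    qed (use alpha l in auto)
    also have "\<dots> = p * D k t + \<alpha> * (LJu + l * LJy) * X k t + bd * D k 0 + bx * X k 0"
      by (simp add: p_def bd_def bx_def add_divide_distrib algebra_simps)
    also have "\<dots> \<le> p * D k t + \<alpha> * C2 * X k t + bd * D k 0 + bx * X k 0"
    proof -
      have "\<alpha> * (LJu + l * LJy) * X k t \<le> \<alpha> * C2 * X k t"
        unfolding C2 using l alpha J1 by (intro mult_right_mono mult_left_mono) (auto simp: X_def)
      then show ?thesis by simp
    qed
    finally show ?thesis by (simp add: D_def)
  qed
  have lim: "(\<lambda>k. norm (uo k - us)) \<longlonglongrightarrow> 0"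
  proof (cases "0 \<le> q")
    case True
    have "(\<lambda>k. D k 0) \<longlonglongrightarrow> 0"
    proof (rule two_timescale_convergence[where x = X])
      show "D k (Suc t) \<le> p * D k t + \<alpha> * C2 * X k t + bd * D k 0 + bx * X k 0" if "t < T" for k t
        by (rule D_step[OF that])
      show "X k (Suc t) \<le> Guf * D k t + \<rho>f * X k t" if "t < T" for k t
        by (rule X_step[OF that])
      show "0 \<le> p" using True alpha J1 l by (simp add: p_def)
    qed (use gain T S1 alpha C2_pos Guf b in \<open>auto simp: D_def X_def alg'\<close>)
    then show ?thesis by (simp add: D_def alg')
  next
    case False
    \<comment> \<open>the radicand is then negative, \<open>sqrt\<close> takes a negative value, and \<open>us\<close> is the only point of \<open>U\<close>\<close>
    have "uo k = us" for k
    proof -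
      have "0 \<le> q * norm (uo k - us)"
        using order_trans[OF norm_ge_zero q[OF uo_U]] .
      with False have "norm (uo k - us) \<le> 0" by (simp add: zero_le_mult_iff)
      then show ?thesis by simp
    qed
    then show ?thesis by simp
  qed
  have "limsup (\<lambda>k. ereal (norm (uo k - us))) = ereal 0"
    by (rule lim_imp_Limsup) (use lim in \<open>auto intro: tendsto_ereal\<close>)
  also have "\<dots> \<le> ereal (\<alpha>\<^sup>2 * GyJ * C * (GuJ + Lh * GyJ) / (1 - spectral_radius (map_mat complex_of_real M)) *
      (Lh / (1 - \<rho>f) + (real T - 1) * (1 + Guf / (1 - \<rho>f))))"
    unfolding ereal_less_eq(3)
    using C_nonneg rho_M J1 Lh S1 T Guf
    by (intro mult_nonneg_nonneg divide_nonneg_nonneg add_nonneg_nonneg) auto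
  finally show ?thesis .
qed

end
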